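(* Let $(\Omega,\mathcal{A},\mu)$ be a measure space for which there is a countable family $\{A_n:n\in\mathbb{N}\}\subset\mathcal{A}$ of mutually disjoint measurable sets such that $\inf_{n\in\mathbb{N}}\mu(A_n)>0$. Then $\mathcal{S}_p\setminus\mathcal{S}_m$ is strongly $\mathfrak{c}$-algebrable. In particular, the sets $\mathcal{S}_p\setminus\bigcup_{q>0}\mathcal{S}_{L_q}$, $\mathcal{S}_p\setminus\mathcal{S}_c$, $\mathcal{S}_p\setminus\mathcal{S}_{au}$ and $\mathcal{S}_p\setminus\mathcal{S}_u$ are strongly $\mathfrak{c}$-algebrable.
   Context: $(\Omega,\mathcal{A},\mu)$ is a positive measure space. $L_0$ is the real vector space of ($\mu$-a.e. equality classes of) measurable functions $f:\Omega\to\mathbb{R}$. $L_0^{\mathbb{N}}$ is the commutative real algebra of all sequences $(f_n)_{n\in\mathbb{N}}$ in $L_0$ with coordinatewise operations, in particular $(f_n)\cdot(g_n):=(f_ng_n)$. Subsets of $L_0^{\mathbb{N}}$: $\mathcal{S}_p$: sequences with $f_n\to0$ pointwise almost everywhere. $\mathcal{S}_u$: $f_n\to0$ uniformly almost everywhere (there is $Z\in\mathcal{A}$ with $\mu(Z)=0$ and $f_n\to0$ uniformly on $\Omega\setminus Z$). $\mathcal{S}_{au}$: $f_n\to0$ almost uniformly (for every $\varepsilon>0$ there is $Z_\varepsilon\in\mathcal{A}$ with $\mu(Z_\varepsilon)<\varepsilon$ and $f_n\to0$ uniformly on $\Omega\setminus Z_\varepsilon$). $\mathcal{S}_m$: $f_n\to0$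 in measure ($\lim_n\mu(\{|f_n|>\varepsilon\})=0$ for every $\varepsilon>0$). $\mathcal{S}_{L_q}$ ($q\in(0,+\infty)$): $\lim_n\int_\Omega|f_n|^q\,d\mu=0$. $\mathcal{S}_c$: $f_n\to0$ completely ($\sum_{n=1}^\infty\mu(\{|f_n|>\varepsilon\})<\infty$ for every $\varepsilon>0$). $\mathfrak{c}$ is the cardinality of the continuum. A subset $A$ of a commutative algebra is strongly $\mathfrak{c}$-algebrable if there is a $\mathfrak{c}$-generated free algebra $M$ with $M\setminus\{0\}\subset A$; that is, there is a subset $B$ of the algebra of cardinality $\mathfrak{c}$ such that for any positive integer $N$, any nonzero real polynomial $P$ in $N$ variables without constant term and any distinct $x_1,\dots,x_N\in B$, one has $P(x_1,\dots,x_N)\in A\setminus\{0\}$. *)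

theory Defs
  imports
    "HOL-Analysis.Analysis"
    "HOL-Algebra.Module"
    "HOL-Library.Poly_Mapping"
    "HOL-Library.Equipollence"
begin

section \<open>The algebra of sequences in \<open>L\<^sub>0\<close>\<close>

definition ae_rel :: "'a measure \<Rightarrow> (('a \<Rightarrow> real) \<times> ('a \<Rightarrow> real)) set" where
  "ae_rel M = {(f, g). f \<in> borel_measurable M \<and> g \<in> borel_measurable M \<and> (AE x in M. f x = g x)}"

text \<open>
  \<open>L\<^sub>0\<close> depends on the measure \<open>M\<close>, so it is a set of equivalence classes rather than a type.
  Functions are total on the type \<open>'a\<close>, but \<open>ae_rel M\<close> ignores their values outside \<open>space M\<close>.
\<close>

definition L0 :: "'a measure \<Rightarrow> ('a \<Rightarrow> real) set set" where
  "L0 M = borel_measurable M // ae_rel M"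

definition L0_class :: "'a measure \<Rightarrow> ('a \<Rightarrow> real) \<Rightarrow> ('a \<Rightarrow> real) set" where
  "L0_class M f = ae_rel M `` {f}"

definition L0_add :: "'a measure \<Rightarrow> ('a \<Rightarrow> real) set \<Rightarrow> ('a \<Rightarrow> real) set \<Rightarrow> ('a \<Rightarrow> real) set" where
  "L0_add M F G = (\<Union>f\<in>F. \<Union>g\<in>G. L0_class M (\<lambda>x. f x + g x))"

definition L0_mult :: "'a measure \<Rightarrow> ('a \<Rightarrow> real) set \<Rightarrow> ('a \<Rightarrow> real) set \<Rightarrow> ('a \<Rightarrow> real) set" where
  "L0_mult M F G = (\<Union>f\<in>F. \<Union>g\<in>G. L0_class M (\<lambda>x. f x * g x))"

definition L0_smult :: "'a measure \<Rightarrow> real \<Rightarrow> ('a \<Rightarrow> real) set \<Rightarrow> ('a \<Rightarrow> real) set" where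
  "L0_smult M c F = (\<Union>f\<in>F. L0_class M (\<lambda>x. c * f x))"

definition L0_seq_algebra :: "'a measure \<Rightarrow> (real, nat \<Rightarrow> ('a \<Rightarrow> real) set) module" where
  "L0_seq_algebra M =
    \<lparr>carrier = {F. \<forall>n. F n \<in> L0 M},
     mult = (\<lambda>F G n. L0_mult M (F n) (G n)),
     one = (\<lambda>n. L0_class M (\<lambda>x. 1)),
     zero = (\<lambda>n. L0_class M (\<lambda>x. 0)),
     add = (\<lambda>F G n. L0_add M (F n) (G n)),
     smult = (\<lambda>c F n. L0_smult M c (F n))\<rparr>"

subsection \<open>\<open>L0_seq_algebra M\<close> is a commutative real algebra\<close>

lemma equiv_ae_rel: "equiv (borel_measurable M) (ae_rel M)"
  unfolding ae_rel_def
proof (rule equivI)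
  show "trans {(f, g). f \<in> borel_measurable M \<and> g \<in> borel_measurable M \<and> (AE x in M. f x = g x)}"
    by (rule transI) (auto elim: AE_mp)
qed (auto simp: refl_on_def sym_def elim: AE_mp)

lemma L0_class_eq_iff:
  assumes "f \<in> borel_measurable M" "g \<in> borel_measurable M"
  shows "L0_class M f = L0_class M g \<longleftrightarrow> (AE x in M. f x = g x)"
  using assms eq_equiv_class_iff[OF equiv_ae_rel assms] by (auto simp: L0_class_def ae_rel_def)

lemma L0_class_in_L0: "f \<in> borel_measurable M \<Longrightarrow> L0_class M f \<in> L0 M"
  by (auto simp: L0_class_def L0_def quotient_def)

lemma L0_E:
  assumes "F \<in> L0 M"
  obtains f where "f \<in> borel_measurable M" "F = L0_class M f"
  using assms by (auto simp: L0_class_def L0_def quotient_def)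

lemma L0_add_class:
  assumes "f \<in> borel_measurable M" "g \<in> borel_measurable M"
  shows "L0_add M (L0_class M f) (L0_class M g) = L0_class M (\<lambda>x. f x + g x)"
proof -
  have "congruent2 (ae_rel M) (ae_rel M) (\<lambda>f g. L0_class M (\<lambda>x. f x + g x))"
    by (rule congruent2I') (subst L0_class_eq_iff, auto simp: ae_rel_def elim: AE_mp)
  from UN_equiv_class2[OF equiv_ae_rel equiv_ae_rel this assms] show ?thesis
    by (simp add: L0_add_def L0_class_def)
qed

lemma L0_mult_class:
  assumes "f \<in> borel_measurable M" "g \<in> borel_measurable M"
  shows "L0_mult M (L0_class M f) (L0_class M g) = L0_class M (\<lambda>x. f x * g x)"
proof -
  have "congruent2 (ae_rel M) (ae_rel M) (\<lambda>f g. L0_class M (\<lambda>x. f x * g x))"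
    by (rule congruent2I') (subst L0_class_eq_iff, auto simp: ae_rel_def elim: AE_mp)
  from UN_equiv_class2[OF equiv_ae_rel equiv_ae_rel this assms] show ?thesis
    by (simp add: L0_mult_def L0_class_def)
qed

lemma L0_smult_class:
  assumes "f \<in> borel_measurable M"
  shows "L0_smult M c (L0_class M f) = L0_class M (\<lambda>x. c * f x)"
proof -
  have "congruent (ae_rel M) (\<lambda>f. L0_class M (\<lambda>x. c * f x))"
    by (rule congruentI) (subst L0_class_eq_iff, auto simp: ae_rel_def elim: AE_mp)
  from UN_equiv_class[OF equiv_ae_rel this assms] show ?thesis
    by (simp add: L0_smult_def L0_class_def)
qed

definition real_ring :: "real ring" where
  "real_ring = \<lparr>carrier = UNIV, mult = (*), one = 1, zero = 0, add = (+)\<rparr>"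

lemma cring_real_ring: "cring real_ring"
proof (rule cringI)
  show "abelian_group real_ring"
  proof (rule abelian_groupI)
    fix x assume "x \<in> carrier real_ring"
    show "\<exists>y\<in>carrier real_ring. y \<oplus>\<^bsub>real_ring\<^esub> x = \<zero>\<^bsub>real_ring\<^esub>"
      by (rule bexI[of _ "- x"]) (auto simp: real_ring_def)
  qed (auto simp: real_ring_def)
  show "comm_monoid real_ring"
    by (rule comm_monoidI) (auto simp: real_ring_def)
qed (auto simp: real_ring_def algebra_simps)

lemma L0_seq_carrier_eq:
  "carrier (L0_seq_algebra M) = {\<lambda>n. L0_class M (f n) | f. \<forall>n. f n \<in> borel_measurable M}"
proof (intro Set.equalityI subsetI)
  fix F assume "F \<in> carrier (L0_seq_algebra M)"
  then have "\<forall>n. F n \<in> L0 M" by (simp add: L0_seq_algebra_def)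
  then have "\<forall>n. \<exists>f. f \<in> borel_measurable M \<and> F n = L0_class M f" by (meson L0_E)
  then obtain f where "\<forall>n. f n \<in> borel_measurable M \<and> F n = L0_class M (f n)"
    by metis
  then show "F \<in> {\<lambda>n. L0_class M (f n) | f. \<forall>n. f n \<in> borel_measurable M}" by auto
qed (auto simp: L0_seq_algebra_def L0_class_in_L0)

lemma L0_seq_in_carrier:
  "(\<And>n. f n \<in> borel_measurable M) \<Longrightarrow> (\<lambda>n. L0_class M (f n)) \<in> carrier (L0_seq_algebra M)"
  by (auto simp: L0_seq_algebra_def L0_class_in_L0)

lemma L0_seq_carrier_E:
  assumes "F \<in> carrier (L0_seq_algebra M)"
  obtains f where "\<And>n. f n \<in> borel_measurable M" "F = (\<lambda>n. L0_class M (f n))"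
  using assms by (auto simp: L0_seq_carrier_eq)

lemma L0_seq_ops:
  "\<one>\<^bsub>L0_seq_algebra M\<^esub> = (\<lambda>n. L0_class M (\<lambda>x. 1))"
  "\<zero>\<^bsub>L0_seq_algebra M\<^esub> = (\<lambda>n. L0_class M (\<lambda>x. 0))"
  "\<lbrakk>\<And>n. f n \<in> borel_measurable M; \<And>n. g n \<in> borel_measurable M\<rbrakk> \<Longrightarrow>
    (\<lambda>n. L0_class M (f n)) \<oplus>\<^bsub>L0_seq_algebra M\<^esub> (\<lambda>n. L0_class M (g n)) =
    (\<lambda>n. L0_class M (\<lambda>x. f n x + g n x))"
  "\<lbrakk>\<And>n. f n \<in> borel_measurable M; \<And>n. g n \<in> borel_measurable M\<rbrakk> \<Longrightarrow>
    (\<lambda>n. L0_class M (f n)) \<otimes>\<^bsub>L0_seq_algebra M\<^esub> (\<lambda>n. L0_class M (g n)) =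
    (\<lambda>n. L0_class M (\<lambda>x. f n x * g n x))"
  "(\<And>n. f n \<in> borel_measurable M) \<Longrightarrow>
    c \<odot>\<^bsub>L0_seq_algebra M\<^esub> (\<lambda>n. L0_class M (f n)) = (\<lambda>n. L0_class M (\<lambda>x. c * f n x))"
  by (simp_all add: L0_seq_algebra_def L0_add_class L0_mult_class L0_smult_class)

lemma algebra_L0_seq_algebra: "Module.algebra real_ring (L0_seq_algebra M)"
proof -
  note simps = L0_seq_ops L0_seq_in_carrier real_ring_def algebra_simps
    borel_measurable_add borel_measurable_times borel_measurable_const
  have "abelian_group (L0_seq_algebra M)"
  proof (rule abelian_groupI)
    fix F assume "F \<in> carrier (L0_seq_algebra M)"
    then obtain f where f: "\<And>n. f n \<in> borel_measurable M" "F = (\<lambda>n. L0_class M (f n))"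
      by (rule L0_seq_carrier_E) blast
    show "\<exists>G\<in>carrier (L0_seq_algebra M).
        G \<oplus>\<^bsub>L0_seq_algebra M\<^esub> F = \<zero>\<^bsub>L0_seq_algebra M\<^esub>"
      by (rule bexI[of _ "\<lambda>n. L0_class M (\<lambda>x. - f n x)"]) (use f in \<open>simp_all add: simps\<close>)
  qed (auto elim!: L0_seq_carrier_E simp: simps)
  moreover have "Group.comm_monoid (L0_seq_algebra M)"
    by (rule comm_monoidI) (auto elim!: L0_seq_carrier_E simp: simps)
  ultimately have "cring (L0_seq_algebra M)"
    by (rule cringI) (auto elim!: L0_seq_carrier_E simp: simps)
  then show ?thesis
    by (intro algebraI cring_real_ring) (auto elim!: L0_seq_carrier_E simp: simps)
qed

section \<open>Modes of convergence to zero\<close>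

text \<open>
  Each set is given as the set of sequences of classes having representatives with the stated
  property; all of these properties are invariant under changing every term on a null set.
\<close>

definition L0_seqs :: "'a measure \<Rightarrow> ((nat \<Rightarrow> 'a \<Rightarrow> real) \<Rightarrow> bool) \<Rightarrow> (nat \<Rightarrow> ('a \<Rightarrow> real) set) set" where
  "L0_seqs M Q = {\<lambda>n. L0_class M (f n) | f. (\<forall>n. f n \<in> borel_measurable M) \<and> Q f}"

definition S_p :: "'a measure \<Rightarrow> (nat \<Rightarrow> ('a \<Rightarrow> real) set) set" where
  "S_p M = L0_seqs M (\<lambda>f. AE x in M. (\<lambda>n. f n x) \<longlonglongrightarrow> 0)"

definition S_u :: "'a measure \<Rightarrow> (nat \<Rightarrow> ('a \<Rightarrow> real) set) set" where
  "S_u M = L0_seqs M (\<lambda>f. \<exists>Z\<in>sets M. emeasure M Z = 0 \<and>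
     uniform_limit (space M - Z) f (\<lambda>x. 0) sequentially)"

definition S_au :: "'a measure \<Rightarrow> (nat \<Rightarrow> ('a \<Rightarrow> real) set) set" where
  "S_au M = L0_seqs M (\<lambda>f. \<forall>\<epsilon>::real. \<epsilon> > 0 \<longrightarrow> (\<exists>Z\<in>sets M. emeasure M Z < ennreal \<epsilon> \<and>
     uniform_limit (space M - Z) f (\<lambda>x. 0) sequentially))"

definition S_m :: "'a measure \<Rightarrow> (nat \<Rightarrow> ('a \<Rightarrow> real) set) set" where
  "S_m M = L0_seqs M (\<lambda>f. \<forall>\<epsilon>::real. \<epsilon> > 0 \<longrightarrow>
     (\<lambda>n. emeasure M {x \<in> space M. \<bar>f n x\<bar> > \<epsilon>}) \<longlonglongrightarrow> 0)"

definition S_L :: "real \<Rightarrow> 'a measure \<Rightarrow> (nat \<Rightarrow> ('a \<Rightarrow> real) set) set" where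
  "S_L q M = L0_seqs M (\<lambda>f. (\<lambda>n. \<integral>\<^sup>+ x. ennreal (\<bar>f n x\<bar> powr q) \<partial>M) \<longlonglongrightarrow> 0)"

text \<open>
  Sequences are indexed from \<open>0\<close> here, so the series over \<open>n \<ge> 1\<close> in the definition of complete
  convergence becomes the series over all indices.
\<close>

definition S_c :: "'a measure \<Rightarrow> (nat \<Rightarrow> ('a \<Rightarrow> real) set) set" where
  "S_c M = L0_seqs M (\<lambda>f. \<forall>\<epsilon>::real. \<epsilon> > 0 \<longrightarrow>
     suminf (\<lambda>n. emeasure M {x \<in> space M. \<bar>f n x\<bar> > \<epsilon>}) < \<infinity>)"

section \<open>Strong algebrability\<close>

text \<open>
  A real polynomial in the variables \<open>X\<^sub>0, X\<^sub>1, \<dots>\<close> is a finitely supported map sending a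
  monomial (a finitely supported exponent vector) to its coefficient.
\<close>

type_synonym real_mpoly = "(nat \<Rightarrow>\<^sub>0 nat) \<Rightarrow>\<^sub>0 real"

definition mpoly_in_vars :: "nat \<Rightarrow> real_mpoly \<Rightarrow> bool" where
  "mpoly_in_vars N P \<longleftrightarrow> (\<forall>m\<in>Poly_Mapping.keys P. Poly_Mapping.keys m \<subseteq> {..<N})"

definition mpoly_eval :: "(real, 'b, 'm) module_scheme \<Rightarrow> (nat \<Rightarrow> 'b) \<Rightarrow> real_mpoly \<Rightarrow> 'b" where
  "mpoly_eval L x P =
    (\<Oplus>\<^bsub>L\<^esub>m\<in>Poly_Mapping.keys P. Poly_Mapping.lookup P m \<odot>\<^bsub>L\<^esub>
       (\<Otimes>\<^bsub>L\<^esub>i\<in>Poly_Mapping.keys m. x i [^]\<^bsub>L\<^esub> Poly_Mapping.lookup m i))"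

definition strongly_c_algebrable :: "(real, 'b, 'm) module_scheme \<Rightarrow> 'b set \<Rightarrow> bool" where
  "strongly_c_algebrable L A \<longleftrightarrow>
    (\<exists>B \<subseteq> carrier L. B \<approx> (UNIV :: real set) \<and>
      (\<forall>N>0. \<forall>P x. mpoly_in_vars N P \<and> P \<noteq> 0 \<and> Poly_Mapping.lookup P 0 = 0 \<and>
        inj_on x {..<N} \<and> x ` {..<N} \<subseteq> B \<longrightarrow>
        mpoly_eval L x P \<in> A - {\<zero>\<^bsub>L\<^esub>}))"

end

(*
  Put F_c(n) = sum over k >= n of u_c(k) 1_{A_k}, where (u_c), c real, is a family of functions
  from nat to nat such that any finitely many distinct members take any prescribed values
  simultaneously at infinitely many k.  Since the A_k are disjoint, a polynomial P without constant
  term applied to F_{c_1}, ..., F_{c_N} is equal to P(u_{c_1}(k), ..., u_{c_N}(k)) on A_k for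
  k >= n and vanishes elsewhere, so it tends to 0 pointwise.  If P is nonzero, it does not vanish
  at some natural point v; as (u_{c_i}(k)) = v for infinitely many k, the n-th term exceeds
  |P(v)|/2 on some A_k with k >= n, which rules out convergence in measure.  The other modes of
  convergence imply convergence in measure.
*)
theory Submission
  imports Defs
begin

section \<open>Nonvanishing of polynomials at natural points\<close>

text \<open>Uniqueness of base-\<open>D\<close> digits: reduction mod \<open>D\<close> isolates the
  lowest digit, cancelling it and dividing by \<open>D\<close> shortens the expansion. It separates
  the exponents produced by Kronecker substitution.\<close>

lemma base_expansion_inj:
  fixes a b :: "nat \<Rightarrow> nat"
  assumes "\<And>i. i < N \<Longrightarrow> a i < D" "\<And>i. i < N \<Longrightarrow> b i < D"
    and "(\<Sum>i<N. a i * D ^ i) = (\<Sum>i<N. b i * D ^ i)" and "i < N"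
  shows "a i = b i"
  using assms
proof (induction N arbitrary: a b i)
  case (Suc N)
  have shift: "(\<Sum>i<Suc N. c i * D ^ i) = c 0 + D * (\<Sum>i<N. c (Suc i) * D ^ i)" for c :: "nat \<Rightarrow> nat"
    by (simp only: sum.lessThan_Suc_shift) (simp add: sum_distrib_left algebra_simps)
  have D: "a 0 < D" "b 0 < D" using Suc.prems(1,2) by auto
  have eq: "a 0 + D * (\<Sum>i<N. a (Suc i) * D ^ i) = b 0 + D * (\<Sum>i<N. b (Suc i) * D ^ i)"
    using Suc.prems(3) by (simp only: shift)
  from arg_cong[OF eq, of "\<lambda>n. n mod D"] D have 0: "a 0 = b 0" by simp
  with eq D have "(\<Sum>i<N. a (Suc i) * D ^ i) = (\<Sum>i<N. b (Suc i) * D ^ i)" by simp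
  with Suc.prems(1,2) have "a (Suc j) = b (Suc j)" if "j < N" for j
    using Suc.IH[of "\<lambda>i. a (Suc i)" "\<lambda>i. b (Suc i)" j] that by auto
  with 0 \<open>i < Suc N\<close> show ?case by (cases i) auto
qed simp

text \<open>Kronecker substitution: \<open>X\<^sub>i = t ^ D ^ i\<close> with \<open>D\<close> larger than all exponents keeps the
  monomials distinct.\<close>

lemma mpoly_nonzero_at_nat:
  assumes "mpoly_in_vars N P" "P \<noteq> 0"
  shows "\<exists>v :: nat \<Rightarrow> nat. (\<Sum>m\<in>Poly_Mapping.keys P. Poly_Mapping.lookup P m *
    (\<Prod>i\<in>Poly_Mapping.keys m. real (v i) ^ Poly_Mapping.lookup m i)) \<noteq> 0"
proof -
  define K where "K = Poly_Mapping.keys P"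
  have fin: "finite K" by (simp add: K_def)
  then have "finite (\<Union>m\<in>K. Poly_Mapping.lookup m ` {..<N})" by simp
  then obtain D where D: "\<And>m i. m \<in> K \<Longrightarrow> i < N \<Longrightarrow> Poly_Mapping.lookup m i < D"
    unfolding finite_nat_set_iff_bounded by auto
  \<comment> \<open>\<open>e m\<close> is the power of \<open>t\<close> that the monomial
    \<open>m\<close> becomes; its base-\<open>D\<close> digits are the exponents of
    \<open>m\<close>.\<close>
  define e where "e m = (\<Sum>i<N. Poly_Mapping.lookup m i * D ^ i)" for m :: "nat \<Rightarrow>\<^sub>0 nat"
  have keys: "Poly_Mapping.keys m \<subseteq> {..<N}" if "m \<in> K" for m
    using assms(1) that by (auto simp: mpoly_in_vars_def K_def)
  have inj: "inj_on e K"
  proof (rule inj_onI, rule poly_mapping_eqI)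
    fix m m' i assume *: "m \<in> K" "m' \<in> K" "e m = e m'"
    show "Poly_Mapping.lookup m i = Poly_Mapping.lookup m' i"
    proof (cases "i < N")
      case True
      show ?thesis
        by (rule base_expansion_inj[where N = N and D = D]) (use * D True in \<open>auto simp: e_def\<close>)
    next
      case False
      with keys[OF *(1)] keys[OF *(2)] show ?thesis
        by (metis in_keys_iff lessThan_iff subsetD)
    qed
  qed
  \<comment> \<open>The univariate polynomial obtained from \<open>P\<close> by the substitution.
    Since \<open>e\<close> is injective on \<open>K\<close>, no two monomials merge, so the
    coefficient at \<open>e m0\<close> is that of \<open>m0\<close> in \<open>P\<close>.\<close>
  define q where "q = (\<Sum>m\<in>K. monom (Poly_Mapping.lookup P m) (e m))"
  from assms(2) obtain m0 where m0: "m0 \<in> K" by (metis K_def keys_eq_empty all_not_in_conv)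
  have "coeff q (e m0) = (\<Sum>m\<in>K. if m = m0 then Poly_Mapping.lookup P m else 0)"
    unfolding q_def coeff_sum using inj m0 by (intro sum.cong) (auto dest: inj_onD)
  also have "\<dots> = Poly_Mapping.lookup P m0" using fin m0 by simp
  also have "\<dots> \<noteq> 0" using m0 by (simp add: K_def in_keys_iff)
  finally have "q \<noteq> 0" by auto
  \<comment> \<open>A nonzero \<open>q\<close> has finitely many roots, so some natural number
    avoids them.\<close>
  then have "finite (real -` {x. poly q x = 0})"
    by (intro finite_vimageI poly_roots_finite inj_of_nat)
  then obtain t where t: "poly q (real t) \<noteq> 0"
    by (metis (mono_tags, lifting) ex_new_if_finite infinite_UNIV_nat mem_Collect_eq vimageI)
  have "(\<Prod>i\<in>Poly_Mapping.keys m. real (t ^ D ^ i) ^ Poly_Mapping.lookup m i) = real t ^ e m"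
    if "m \<in> K" for m
  proof -
    have "(\<Prod>i\<in>Poly_Mapping.keys m. real (t ^ D ^ i) ^ Poly_Mapping.lookup m i)
      = (\<Prod>i<N. real (t ^ D ^ i) ^ Poly_Mapping.lookup m i)"
      \<comment> \<open>The added indices have exponent 0 and contribute factors 1.\<close>
      by (rule prod.mono_neutral_left) (use keys[OF that] in \<open>auto simp: in_keys_iff\<close>)
    also have "\<dots> = real t ^ e m"
      by (simp add: e_def power_sum flip: power_mult) (simp add: mult.commute)
    finally show ?thesis .
  qed
  with t have "(\<Sum>m\<in>K. Poly_Mapping.lookup P m *
    (\<Prod>i\<in>Poly_Mapping.keys m. real (t ^ D ^ i) ^ Poly_Mapping.lookup m i)) \<noteq> 0"
    by (simp add: q_def poly_sum poly_monom)
  then show ?thesis unfolding K_def by (rule exI[of _ "\<lambda>i. t ^ D ^ i"])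
qed

section \<open>An independent family of functions\<close>

text \<open>The index \<open>k\<close> codes a finite table of rational intervals with values; the second component
  of the code is a dummy that makes each table occur infinitely often.\<close>

definition indep_fun :: "real \<Rightarrow> nat \<Rightarrow> nat" where
  "indep_fun c k = (\<Sum>(p, q, v)\<leftarrow>fst (from_nat k :: (rat \<times> rat \<times> nat) list \<times> nat).
     if of_rat p < c \<and> c < of_rat q then v else 0)"

text \<open>Finitely many distinct reals can be separated by rational intervals. The table assigning
  \<open>v i\<close> to the interval around \<open>c i\<close> then has codes \<open>k\<close> with
  the required values, and its dummy component makes \<open>k\<close> as large as desired.\<close>

lemma indep_fun_attains:
  fixes c :: "nat \<Rightarrow> real"
  assumes "inj_on c {..<N}"
  shows "\<exists>k\<ge>n. \<forall>i<N. indep_fun (c i) k = v i"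
proof -
  have "\<exists>p q. of_rat p < c i \<and> c i < of_rat q \<and> (\<forall>j<N. of_rat p < c j \<and> c j < of_rat q \<longrightarrow> j = i)"
    if i: "i < N" for i
  proof -
    \<comment> \<open>\<open>d\<close> bounds from below the distance from \<open>c i\<close> to the
      other points; rational endpoints within \<open>d\<close> of \<open>c i\<close> isolate
      it.\<close>
    obtain d where d: "d > 0" "\<And>x. x \<in> c ` {..<N} \<Longrightarrow> x \<noteq> c i \<Longrightarrow> d \<le> dist (c i) x"
      using finite_set_avoid[OF finite_imageI[OF finite_lessThan], of c N "c i"] by blast
    obtain p where p: "c i - d < of_rat p" "of_rat p < c i"
      using of_rat_dense[of "c i - d" "c i"] d(1) by auto
    obtain q where q: "c i < of_rat q" "of_rat q < c i + d"
      using of_rat_dense[of "c i" "c i + d"] d(1) by auto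
    have "j = i" if "j < N" "of_rat p < c j" "c j < of_rat q" for j
    proof (rule ccontr)
      assume "j \<noteq> i"
      with assms i that(1) have "c j \<noteq> c i" by (auto dest: inj_onD)
      with d(2)[of "c j"] that p q show False by (auto simp: dist_real_def)
    qed
    with p q show ?thesis by blast
  qed
  then obtain p q where pq: "\<And>i. i < N \<Longrightarrow> of_rat (p i) < c i" "\<And>i. i < N \<Longrightarrow> c i < of_rat (q i)"
    "\<And>i j. i < N \<Longrightarrow> j < N \<Longrightarrow> of_rat (p i) < c j \<Longrightarrow> c j < of_rat (q i) \<Longrightarrow> j = i"
    by metis
  define T where "T = map (\<lambda>i. (p i, q i, v i)) [0..<N]"
  \<comment> \<open>Varying the dummy \<open>j\<close> gives infinitely many codes of the same
    table, hence one beyond \<open>n\<close>.\<close>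
  have "inj (\<lambda>j :: nat. to_nat (T, j))" by (auto simp: inj_def)
  then have "infinite (range (\<lambda>j :: nat. to_nat (T, j)))" by (rule range_inj_infinite)
  then obtain j where j: "n \<le> to_nat (T, j :: nat)"
    unfolding infinite_nat_iff_unbounded_le by auto
  have "indep_fun (c i) (to_nat (T, j)) = v i" if i: "i < N" for i
  proof -
    have "indep_fun (c i) (to_nat (T, j))
      = (\<Sum>l<N. if of_rat (p l) < c i \<and> c i < of_rat (q l) then v l else 0)"
      by (simp add: indep_fun_def T_def o_def interv_sum_list_conv_sum_set_nat atLeast0LessThan)
    \<comment> \<open>Only the \<open>i\<close>-th interval contains \<open>c i\<close>, so a single
      entry of the table counts.\<close>
    also have "\<dots> = (\<Sum>l<N. if l = i then v l else 0)"
      using pq i by (intro sum.cong) (auto dest: pq(3))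
    finally show ?thesis using i by simp
  qed
  with j show ?thesis by blast
qed

section \<open>Evaluation of polynomials on representatives\<close>

lemma L0_seq_comm_monoid: "comm_monoid (L0_seq_algebra M)"
  using algebra_L0_seq_algebra[of M] by (simp add: algebra_def cring_def)

lemma L0_seq_pow:
  assumes [measurable]: "\<And>n. f n \<in> borel_measurable M"
  shows "(\<lambda>n. L0_class M (f n)) [^]\<^bsub>L0_seq_algebra M\<^esub> (k :: nat) = (\<lambda>n. L0_class M (\<lambda>t. f n t ^ k))"
proof -
  interpret Module.algebra real_ring "L0_seq_algebra M" by (rule algebra_L0_seq_algebra)
  show ?thesis
    by (induction k) (simp_all add: L0_seq_ops mult.commute)
qed

lemma L0_seq_finprod:
  assumes "finite I" "\<And>i n. i \<in> I \<Longrightarrow> f i n \<in> borel_measurable M"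
  shows "(\<Otimes>\<^bsub>L0_seq_algebra M\<^esub>i\<in>I. (\<lambda>n. L0_class M (f i n))) = (\<lambda>n. L0_class M (\<lambda>t. \<Prod>i\<in>I. f i n t))"
proof -
  interpret Module.algebra real_ring "L0_seq_algebra M" by (rule algebra_L0_seq_algebra)
  show ?thesis using assms
  proof (induction I)
    case (insert i I)
    have "(\<Otimes>\<^bsub>L0_seq_algebra M\<^esub>i\<in>insert i I. (\<lambda>n. L0_class M (f i n)))
      = (\<lambda>n. L0_class M (f i n)) \<otimes>\<^bsub>L0_seq_algebra M\<^esub> (\<Otimes>\<^bsub>L0_seq_algebra M\<^esub>i\<in>I. (\<lambda>n. L0_class M (f i n)))"
      using insert by (intro comm_monoid.finprod_insert[OF L0_seq_comm_monoid]) (auto intro!: L0_seq_in_carrier)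
    with insert show ?case by (simp add: L0_seq_ops)
  qed (simp add: L0_seq_ops)
qed

lemma L0_seq_finsum:
  assumes "finite I" "\<And>i n. i \<in> I \<Longrightarrow> f i n \<in> borel_measurable M"
  shows "(\<Oplus>\<^bsub>L0_seq_algebra M\<^esub>i\<in>I. (\<lambda>n. L0_class M (f i n))) = (\<lambda>n. L0_class M (\<lambda>t. \<Sum>i\<in>I. f i n t))"
proof -
  interpret Module.algebra real_ring "L0_seq_algebra M" by (rule algebra_L0_seq_algebra)
  show ?thesis using assms
  proof (induction I)
    case (insert i I)
    have "(\<Oplus>\<^bsub>L0_seq_algebra M\<^esub>i\<in>insert i I. (\<lambda>n. L0_class M (f i n)))
      = (\<lambda>n. L0_class M (f i n)) \<oplus>\<^bsub>L0_seq_algebra M\<^esub> (\<Oplus>\<^bsub>L0_seq_algebra M\<^esub>i\<in>I. (\<lambda>n. L0_class M (f i n)))"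
      using insert by (intro M.finsum_insert) (auto intro!: L0_seq_in_carrier)
    with insert show ?case by (simp add: L0_seq_ops)
  qed (simp add: L0_seq_ops)
qed

text \<open>Bridges the abstract ring operations and pointwise computation: sums, products and
  powers of classes may all be formed on measurable representatives.\<close>

lemma mpoly_eval_L0_seq:
  assumes P: "mpoly_in_vars N P"
    and f: "\<And>i n. i < N \<Longrightarrow> f i n \<in> borel_measurable M"
    and x: "\<And>i. i < N \<Longrightarrow> x i = (\<lambda>n. L0_class M (f i n))"
  shows "mpoly_eval (L0_seq_algebra M) x P = (\<lambda>n. L0_class M (\<lambda>t.
    \<Sum>m\<in>Poly_Mapping.keys P. Poly_Mapping.lookup P m *
      (\<Prod>i\<in>Poly_Mapping.keys m. f i n t ^ Poly_Mapping.lookup m i)))"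
proof -
  interpret Module.algebra real_ring "L0_seq_algebra M" by (rule algebra_L0_seq_algebra)
  \<comment> \<open>Only variables below \<open>N\<close> occur, and these are the ones whose
    representatives are given.\<close>
  have keys: "i < N" if "m \<in> Poly_Mapping.keys P" "i \<in> Poly_Mapping.keys m" for m i
    using P that by (auto simp: mpoly_in_vars_def)
  have meas: "(\<lambda>t. f i n t ^ Poly_Mapping.lookup m i) \<in> borel_measurable M"
    if "m \<in> Poly_Mapping.keys P" "i \<in> Poly_Mapping.keys m" for m i n
    by (intro borel_measurable_power f keys[OF that])
  have term_eq: "Poly_Mapping.lookup P m \<odot>\<^bsub>L0_seq_algebra M\<^esub>
      (\<Otimes>\<^bsub>L0_seq_algebra M\<^esub>i\<in>Poly_Mapping.keys m. x i [^]\<^bsub>L0_seq_algebra M\<^esub> Poly_Mapping.lookup m i)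
    = (\<lambda>n. L0_class M (\<lambda>t. Poly_Mapping.lookup P m *
      (\<Prod>i\<in>Poly_Mapping.keys m. f i n t ^ Poly_Mapping.lookup m i)))"
    if m: "m \<in> Poly_Mapping.keys P" for m
  proof -
    have "(\<Otimes>\<^bsub>L0_seq_algebra M\<^esub>i\<in>Poly_Mapping.keys m. x i [^]\<^bsub>L0_seq_algebra M\<^esub> Poly_Mapping.lookup m i)
      = (\<Otimes>\<^bsub>L0_seq_algebra M\<^esub>i\<in>Poly_Mapping.keys m.
          (\<lambda>n. L0_class M (\<lambda>t. f i n t ^ Poly_Mapping.lookup m i)))"
      by (intro comm_monoid.finprod_cong'[OF L0_seq_comm_monoid])
        (auto simp: x f keys[OF m] L0_seq_pow intro!: L0_seq_in_carrier meas[OF m])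
    also have "\<dots> = (\<lambda>n. L0_class M (\<lambda>t. \<Prod>i\<in>Poly_Mapping.keys m. f i n t ^ Poly_Mapping.lookup m i))"
      by (intro L0_seq_finprod) (auto intro!: meas[OF m])
    finally show ?thesis
      using meas[OF m] by (simp add: L0_seq_ops borel_measurable_prod)
  qed
  have "mpoly_eval (L0_seq_algebra M) x P = (\<Oplus>\<^bsub>L0_seq_algebra M\<^esub>m\<in>Poly_Mapping.keys P.
      (\<lambda>n. L0_class M (\<lambda>t. Poly_Mapping.lookup P m *
        (\<Prod>i\<in>Poly_Mapping.keys m. f i n t ^ Poly_Mapping.lookup m i))))"
    unfolding mpoly_eval_def
    by (intro M.finsum_cong')
      (auto simp: term_eq intro!: L0_seq_in_carrier borel_measurable_times borel_measurable_prod meas)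
  also have "\<dots> = (\<lambda>n. L0_class M (\<lambda>t. \<Sum>m\<in>Poly_Mapping.keys P. Poly_Mapping.lookup P m *
      (\<Prod>i\<in>Poly_Mapping.keys m. f i n t ^ Poly_Mapping.lookup m i)))"
    by (intro L0_seq_finsum) (auto intro!: borel_measurable_times borel_measurable_prod meas)
  finally show ?thesis .
qed

section \<open>Comparison with convergence in measure\<close>

lemma L0_seqs_mono:
  assumes "\<And>f. (\<And>n. f n \<in> borel_measurable M) \<Longrightarrow> Q f \<Longrightarrow> Q' f"
  shows "L0_seqs M Q \<subseteq> L0_seqs M Q'"
  using assms by (fastforce simp: L0_seqs_def)

text \<open>Membership only provides some representatives; changing each term on a null set leaves
  the measures of \<open>{\<bar>f n x\<bar> > \<epsilon>}\<close> unchanged. This lets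
  non-membership be tested on one chosen representative.\<close>

lemma S_m_iff:
  assumes "\<And>n. f n \<in> borel_measurable M"
  shows "(\<lambda>n. L0_class M (f n)) \<in> S_m M \<longleftrightarrow>
    (\<forall>\<epsilon>>0. (\<lambda>n. emeasure M {x \<in> space M. \<bar>f n x\<bar> > \<epsilon>}) \<longlonglongrightarrow> 0)"
proof
  assume "(\<lambda>n. L0_class M (f n)) \<in> S_m M"
  then obtain g where g: "\<And>n. g n \<in> borel_measurable M" "\<And>n. L0_class M (f n) = L0_class M (g n)"
    and lim: "\<And>\<epsilon>. \<epsilon> > 0 \<Longrightarrow> (\<lambda>n. emeasure M {x \<in> space M. \<bar>g n x\<bar> > \<epsilon>}) \<longlonglongrightarrow> 0"
    by (auto simp: S_m_def L0_seqs_def fun_eq_iff)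
  note [measurable] = g(1) assms
  have "emeasure M {x \<in> space M. \<bar>f n x\<bar> > \<epsilon>} = emeasure M {x \<in> space M. \<bar>g n x\<bar> > \<epsilon>}" for n and \<epsilon> :: real
  proof (rule emeasure_eq_AE)
    have "AE x in M. f n x = g n x"
      using g(2)[of n] L0_class_eq_iff[of "f n" M "g n"] g(1) assms by auto
    then show "AE x in M. x \<in> {x \<in> space M. \<bar>f n x\<bar> > \<epsilon>} \<longleftrightarrow> x \<in> {x \<in> space M. \<bar>g n x\<bar> > \<epsilon>}"
      by eventually_elim auto
  qed measurable
  with lim show "\<forall>\<epsilon>>0. (\<lambda>n. emeasure M {x \<in> space M. \<bar>f n x\<bar> > \<epsilon>}) \<longlonglongrightarrow> 0" by simp
next
  assume "\<forall>\<epsilon>>0. (\<lambda>n. emeasure M {x \<in> space M. \<bar>f n x\<bar> > \<epsilon>}) \<longlonglongrightarrow> 0"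
  with assms show "(\<lambda>n. L0_class M (f n)) \<in> S_m M" by (auto simp: S_m_def L0_seqs_def)
qed

text \<open>Markov's inequality for \<open>\<bar>f n x\<bar> powr q\<close> at level
  \<open>\<epsilon> powr q\<close>.\<close>

lemma S_L_subset_S_m:
  assumes "q > 0"
  shows "S_L q M \<subseteq> S_m M"
  unfolding S_L_def S_m_def
proof (rule L0_seqs_mono, intro allI impI)
  fix f :: "nat \<Rightarrow> 'a \<Rightarrow> real" and \<epsilon> :: real
  assume [measurable]: "\<And>n. f n \<in> borel_measurable M" and "\<epsilon> > 0"
    and lim: "(\<lambda>n. \<integral>\<^sup>+ x. ennreal (\<bar>f n x\<bar> powr q) \<partial>M) \<longlonglongrightarrow> 0"
  define c where "c = ennreal (1 / \<epsilon> powr q)"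
  have "emeasure M {x \<in> space M. \<bar>f n x\<bar> > \<epsilon>} \<le> c * (\<integral>\<^sup>+ x. ennreal (\<bar>f n x\<bar> powr q) \<partial>M)" for n
  proof -
    have "emeasure M {x \<in> space M. \<bar>f n x\<bar> > \<epsilon>} = (\<integral>\<^sup>+ x. indicator {x \<in> space M. \<bar>f n x\<bar> > \<epsilon>} x \<partial>M)"
      by simp
    also have "\<dots> \<le> (\<integral>\<^sup>+ x. c * ennreal (\<bar>f n x\<bar> powr q) \<partial>M)"
    proof (intro nn_integral_mono)
      fix x
      show "indicator {x \<in> space M. \<bar>f n x\<bar> > \<epsilon>} x \<le> c * ennreal (\<bar>f n x\<bar> powr q)"
      proof (cases "\<bar>f n x\<bar> > \<epsilon>")
        case True
        then have "\<epsilon> powr q \<le> \<bar>f n x\<bar> powr q" using \<open>\<epsilon> > 0\<close> \<open>q > 0\<close> by (intro powr_mono2) auto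
        then have "1 \<le> 1 / \<epsilon> powr q * \<bar>f n x\<bar> powr q" using \<open>\<epsilon> > 0\<close> by (simp add: field_simps)
        then have "1 \<le> c * ennreal (\<bar>f n x\<bar> powr q)"
          by (simp add: c_def ennreal_mult'[symmetric] del: ennreal_1 flip: ennreal_1)
        then show ?thesis by (auto simp: indicator_def)
      qed auto
    qed
    also have "\<dots> = c * (\<integral>\<^sup>+ x. ennreal (\<bar>f n x\<bar> powr q) \<partial>M)" by (rule nn_integral_cmult) measurable
    finally show ?thesis .
  qed
  moreover have "(\<lambda>n. c * (\<integral>\<^sup>+ x. ennreal (\<bar>f n x\<bar> powr q) \<partial>M)) \<longlonglongrightarrow> 0"
    \<comment> \<open>The constant \<open>c\<close> is finite, so multiplication by it preserves the
      limit 0.\<close>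
    using ennreal_tendsto_cmult[OF _ lim, of c] by (simp add: c_def)
  ultimately show "(\<lambda>n. emeasure M {x \<in> space M. \<bar>f n x\<bar> > \<epsilon>}) \<longlonglongrightarrow> 0"
    using tendsto_sandwich[OF _ _ tendsto_const] by (metis (lifting) always_eventually zero_le)
qed

text \<open>The terms of a convergent series tend to 0.\<close>

lemma S_c_subset_S_m: "S_c M \<subseteq> S_m M"
  unfolding S_c_def S_m_def
proof (rule L0_seqs_mono, intro allI impI)
  fix f :: "nat \<Rightarrow> 'a \<Rightarrow> real" and \<epsilon> :: real
  define a where "a n = emeasure M {x \<in> space M. \<bar>f n x\<bar> > \<epsilon>}" for n
  assume "\<epsilon> > 0" and "\<forall>\<epsilon>::real. \<epsilon> > 0 \<longrightarrow> suminf (\<lambda>n. emeasure M {x \<in> space M. \<bar>f n x\<bar> > \<epsilon>}) < \<infinity>"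
  then have fin: "suminf a < \<infinity>" unfolding a_def by blast
  \<comment> \<open>A finite sum has finite terms, so the argument can pass to real series and
    back.\<close>
  then have "a n < \<infinity>" for n by (rule ennreal_suminf_lessD)
  then have a: "a n = ennreal (enn2real (a n))" for n by simp
  have "summable (\<lambda>n. enn2real (a n))"
    by (rule summable_suminf_not_top) (use fin a in auto)
  from tendsto_ennrealI[OF summable_LIMSEQ_zero[OF this]]
  show "(\<lambda>n. emeasure M {x \<in> space M. \<bar>f n x\<bar> > \<epsilon>}) \<longlonglongrightarrow> 0"
    by (simp add: a[symmetric] flip: a_def)
qed

lemma S_u_subset_S_au: "S_u M \<subseteq> S_au M"
  unfolding S_u_def S_au_def by (rule L0_seqs_mono) (metis ennreal_0 ennreal_less_iff order_refl)

text \<open>Uniform convergence off \<open>Z\<close> eventually confines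
  \<open>{\<bar>f n x\<bar> > \<epsilon>}\<close> to \<open>Z\<close>, whose measure can be made
  arbitrarily small.\<close>

lemma S_au_subset_S_m: "S_au M \<subseteq> S_m M"
  unfolding S_au_def S_m_def
proof (rule L0_seqs_mono, intro allI impI)
  fix f :: "nat \<Rightarrow> 'a \<Rightarrow> real" and \<epsilon> :: real
  assume [measurable]: "\<And>n. f n \<in> borel_measurable M" and "\<epsilon> > 0"
    and au: "\<forall>\<delta>::real. \<delta> > 0 \<longrightarrow> (\<exists>Z\<in>sets M. emeasure M Z < ennreal \<delta> \<and>
      uniform_limit (space M - Z) f (\<lambda>x. 0) sequentially)"
  show "(\<lambda>n. emeasure M {x \<in> space M. \<bar>f n x\<bar> > \<epsilon>}) \<longlonglongrightarrow> 0"
  proof (rule order_tendstoI)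
    fix a :: ennreal assume "0 < a"
    \<comment> \<open>The bound \<open>a\<close> may be infinite, in which case
      \<open>\<delta> = 1\<close> serves.\<close>
    then obtain \<delta> :: real where \<delta>: "\<delta> > 0" "ennreal \<delta> \<le> a"
      by (cases a) (auto intro: that[of 1] simp: top_unique)
    with au obtain Z where Z: "Z \<in> sets M" "emeasure M Z < ennreal \<delta>"
      "uniform_limit (space M - Z) f (\<lambda>x. 0) sequentially" by blast
    from uniform_limitD[OF Z(3) \<open>\<epsilon> > 0\<close>]
    show "\<forall>\<^sub>F n in sequentially. emeasure M {x \<in> space M. \<bar>f n x\<bar> > \<epsilon>} < a"
    proof eventually_elim
      case (elim n)
      then have "{x \<in> space M. \<bar>f n x\<bar> > \<epsilon>} \<subseteq> Z" by (force simp: dist_real_def)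
      then have "emeasure M {x \<in> space M. \<bar>f n x\<bar> > \<epsilon>} \<le> emeasure M Z"
        using Z(1) by (rule emeasure_mono)
      also have "\<dots> < a" using Z(2) \<delta>(2) by simp
      finally show ?case .
    qed
  qed simp
qed

text \<open>The same generators work for the larger set, so the case of \<open>S_m\<close> yields
  the other modes.\<close>

lemma strongly_c_algebrable_mono:
  assumes "strongly_c_algebrable L A" "A \<subseteq> A'"
  shows "strongly_c_algebrable L A'"
proof -
  have "A - {\<zero>\<^bsub>L\<^esub>} \<subseteq> A' - {\<zero>\<^bsub>L\<^esub>}" using assms(2) by blast
  then show ?thesis using assms(1) unfolding strongly_c_algebrable_def by (meson subsetD)
qed

section \<open>The free algebra\<close>

text \<open>Encodes the sum over k >= n of \<open>u k\<close> times the indicator of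
  \<open>A k\<close>, for disjoint \<open>A k\<close>. Reading off one index with
  \<open>LEAST\<close> avoids infinite sums and lets polynomials act on the values of
  \<open>u\<close>.\<close>

definition tail_fun :: "(nat \<Rightarrow> 'a set) \<Rightarrow> (nat \<Rightarrow> real) \<Rightarrow> nat \<Rightarrow> 'a \<Rightarrow> real" where
  "tail_fun A u n t = (if t \<in> (\<Union>k\<in>{n..}. A k) then u (LEAST k. t \<in> A k) else 0)"

lemma tail_fun_measurable:
  assumes "range A \<subseteq> sets M"
  shows "tail_fun A u n \<in> borel_measurable M"
proof -
  have [measurable]: "A k \<in> sets M" for k using assms by auto
  have "(\<lambda>t. u (LEAST k. t \<in> A k)) \<in> borel_measurable M"
    \<comment> \<open>The least index is measurable into the discrete space of naturals, where any
      \<open>u\<close> is measurable.\<close>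
    by (rule measurable_compose[of _ _ "count_space UNIV"]) measurable
  then show ?thesis unfolding tail_fun_def by measurable
qed

lemma tail_fun_eq:
  assumes "disjoint_family A" "t \<in> A k" "n \<le> k"
  shows "tail_fun A u n t = u k"
proof -
  have "(LEAST j. t \<in> A j) = k"
    using assms by (intro Least_equality) (auto simp: disjoint_family_on_def disjoint_iff, metis order_refl)
  with assms show ?thesis by (auto simp: tail_fun_def)
qed

text \<open>A point lies in at most one \<open>A k\<close>, and every term with \<open>n > k\<close>
  vanishes there.\<close>

lemma tail_fun_tendsto_0:
  fixes A :: "nat \<Rightarrow> 'a set"
  assumes "disjoint_family A"
  shows "(\<lambda>n. tail_fun A u n t) \<longlonglongrightarrow> 0"
proof (cases "\<exists>k. t \<in> A k")
  case True
  then obtain k where k: "t \<in> A k" by blast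
  have "tail_fun A u n t = 0" if "n > k" for n
  proof -
    have "t \<notin> A m" if "m \<ge> n" for m
      using disjoint_family_onD[OF assms, of k m] k \<open>n > k\<close> that by auto
    then show ?thesis by (simp add: tail_fun_def)
  qed
  then show ?thesis by (intro tendsto_eventually eventually_sequentiallyI[of "Suc k"]) auto
qed (simp add: tail_fun_def)

lemma tail_fun_in_S_p:
  assumes "range A \<subseteq> sets M" "disjoint_family A"
  shows "(\<lambda>n. L0_class M (tail_fun A u n)) \<in> S_p M"
  using tail_fun_measurable[OF assms(1)] tail_fun_tendsto_0[OF assms(2)]
  by (auto simp: S_p_def L0_seqs_def)

text \<open>For each \<open>n\<close>, the \<open>n\<close>-th term exceeds
  \<open>\<epsilon>\<close> in absolute value on a whole \<open>A k\<close> with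
  \<open>k \<ge> n\<close>, so the measures stay above the positive infimum.\<close>

lemma tail_fun_notin_S_m:
  fixes A :: "nat \<Rightarrow> 'a set"
  assumes A: "range A \<subseteq> sets M" "disjoint_family A" and pos: "(INF n. emeasure M (A n)) > 0"
    and "\<epsilon> > 0" and u: "\<And>n. \<exists>k\<ge>n. \<bar>u k\<bar> > \<epsilon>"
  shows "(\<lambda>n. L0_class M (tail_fun A u n)) \<notin> S_m M"
proof
  note [measurable] = tail_fun_measurable[OF A(1)]
  assume "(\<lambda>n. L0_class M (tail_fun A u n)) \<in> S_m M"
  with \<open>\<epsilon> > 0\<close> have "(\<lambda>n. emeasure M {x \<in> space M. \<bar>tail_fun A u n x\<bar> > \<epsilon>}) \<longlonglongrightarrow> 0"
    by (simp add: S_m_iff)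
  moreover have "(INF n. emeasure M (A n)) \<le> emeasure M {x \<in> space M. \<bar>tail_fun A u n x\<bar> > \<epsilon>}" for n
  proof -
    obtain k where k: "k \<ge> n" "\<bar>u k\<bar> > \<epsilon>" using u by blast
    have "(INF n. emeasure M (A n)) \<le> emeasure M (A k)" by (rule INF_lower) simp
    also have "\<dots> \<le> emeasure M {x \<in> space M. \<bar>tail_fun A u n x\<bar> > \<epsilon>}"
    proof (rule emeasure_mono)
      show "A k \<subseteq> {x \<in> space M. \<bar>tail_fun A u n x\<bar> > \<epsilon>}"
        using k A sets.sets_into_space[of "A k" M] by (auto simp: tail_fun_eq[OF A(2) _ k(1)])
    qed measurable
    finally show ?thesis .
  qed
  ultimately have "(INF n. emeasure M (A n)) \<le> 0" by (intro LIMSEQ_le_const) auto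
  with pos show False by simp
qed

text \<open>At a point of the union all factors are evaluated at the same index. Off the union every
  monomial vanishes: without a constant term, each contains a variable, whose value is 0.\<close>

lemma mpoly_tail_fun:
  assumes "Poly_Mapping.lookup P 0 = 0"
  shows "(\<Sum>m\<in>Poly_Mapping.keys P. Poly_Mapping.lookup P m *
      (\<Prod>i\<in>Poly_Mapping.keys m. tail_fun A (u i) n t ^ Poly_Mapping.lookup m i))
    = tail_fun A (\<lambda>k. \<Sum>m\<in>Poly_Mapping.keys P. Poly_Mapping.lookup P m *
      (\<Prod>i\<in>Poly_Mapping.keys m. u i k ^ Poly_Mapping.lookup m i)) n t"
proof (cases "t \<in> (\<Union>k\<in>{n..}. A k)")
  case False
  have "(\<Prod>i\<in>Poly_Mapping.keys m. tail_fun A (u i) n t ^ Poly_Mapping.lookup m i) = 0"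
    if "m \<in> Poly_Mapping.keys P" for m
  proof -
    have "m \<noteq> 0" using that assms by (auto simp: in_keys_iff)
    then obtain i where "i \<in> Poly_Mapping.keys m" by (metis keys_eq_empty all_not_in_conv)
    with False show ?thesis by (auto simp: tail_fun_def in_keys_iff intro!: prod_zero)
  qed
  then have "(\<Sum>m\<in>Poly_Mapping.keys P. Poly_Mapping.lookup P m *
      (\<Prod>i\<in>Poly_Mapping.keys m. tail_fun A (u i) n t ^ Poly_Mapping.lookup m i)) = 0"
    by (simp only: mult_zero_right sum.neutral_const cong: sum.cong)
  with False show ?thesis by (simp only: tail_fun_def if_False)
qed (simp add: tail_fun_def)

lemma S_p_minus_S_m_strongly_c_algebrable:
  fixes A :: "nat \<Rightarrow> 'a set"
  assumes A: "range A \<subseteq> sets M" "disjoint_family A" and pos: "(INF n. emeasure M (A n)) > 0"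
  shows "strongly_c_algebrable (L0_seq_algebra M) (S_p M - S_m M)"
proof -
  define F where "F c = (\<lambda>n. L0_class M (tail_fun A (\<lambda>k. real (indep_fun c k)) n))" for c
  note meas = tail_fun_measurable[OF A(1)]
  \<comment> \<open>Gives \<open>range F\<close> the cardinality of the continuum. For
    \<open>c \<noteq> d\<close> some index \<open>k\<close> has values 0 and 1, so equal classes
    would force \<open>A k\<close> to be null.\<close>
  have "inj F"
  proof (rule injI, rule ccontr)
    fix c d assume eq: "F c = F d" and "c \<noteq> d"
    then have "inj_on (\<lambda>i. if i = 0 then c else d) {..<2 :: nat}"
      by (auto simp: inj_on_def)
    from indep_fun_attains[OF this, of 0 "\<lambda>i. i"]
    obtain k where "\<forall>i<2. indep_fun (if i = 0 then c else d) k = i" by blast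
    from this[rule_format, of 0] this[rule_format, of 1]
    have k: "indep_fun c k = 0" "indep_fun d k = 1" by auto
    from fun_cong[OF eq, of 0]
    have "AE x in M. tail_fun A (\<lambda>k. real (indep_fun c k)) 0 x = tail_fun A (\<lambda>k. real (indep_fun d k)) 0 x"
      by (simp add: F_def L0_class_eq_iff[OF meas meas])
    then have "AE x in M. x \<notin> A k"
      by eventually_elim (auto simp: tail_fun_eq[OF A(2)] k)
    then have "emeasure M (A k) = 0"
      using A(1) sets.sets_into_space[of "A k" M] by (subst (asm) AE_iff_measurable[of "A k"]) auto
    moreover have "(INF n. emeasure M (A n)) \<le> emeasure M (A k)" by (rule INF_lower) simp
    ultimately show False using pos by simp
  qed
  then have "range F \<approx> (UNIV :: real set)"
    using inj_on_image_eqpoll_self by blast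
  moreover have "range F \<subseteq> carrier (L0_seq_algebra M)"
    by (auto simp: F_def intro!: L0_seq_in_carrier meas)
  moreover have "mpoly_eval (L0_seq_algebra M) x P \<in> S_p M - S_m M - {\<zero>\<^bsub>L0_seq_algebra M\<^esub>}"
    if P: "mpoly_in_vars N P" "P \<noteq> 0" "Poly_Mapping.lookup P 0 = 0"
      and x: "inj_on x {..<N}" "x ` {..<N} \<subseteq> range F" for N P x
  proof -
    from x(2) have "\<forall>i\<in>{..<N}. \<exists>c. x i = F c" by blast
    then obtain c where c: "\<And>i. i < N \<Longrightarrow> x i = F (c i)" by (metis lessThan_iff)
    \<comment> \<open>Distinct generators come from distinct parameters, as independence
      requires.\<close>
    have inj: "inj_on c {..<N}"
      using x(1) c by (metis inj_on_def lessThan_iff)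
    define p where "p w = (\<Sum>m\<in>Poly_Mapping.keys P. Poly_Mapping.lookup P m *
      (\<Prod>i\<in>Poly_Mapping.keys m. w i ^ Poly_Mapping.lookup m i))" for w :: "nat \<Rightarrow> real"
    define u where "u k = p (\<lambda>i. real (indep_fun (c i) k))" for k
    have eval: "mpoly_eval (L0_seq_algebra M) x P = (\<lambda>n. L0_class M (tail_fun A u n))"
      unfolding u_def p_def mpoly_tail_fun[OF P(3), symmetric]
      by (subst mpoly_eval_L0_seq[OF P(1), where f = "\<lambda>i. tail_fun A (\<lambda>k. real (indep_fun (c i) k))"])
        (auto simp: c F_def meas mpoly_tail_fun[OF P(3)])
    obtain v :: "nat \<Rightarrow> nat" where v: "p (\<lambda>i. real (v i)) \<noteq> 0"
      using mpoly_nonzero_at_nat[OF P(1,2)] by (auto simp: p_def)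
    \<comment> \<open>Half of the nonzero value at \<open>v\<close> gives a strict bound whenever
      \<open>u k\<close> takes that value.\<close>
    have "\<exists>k\<ge>n. \<bar>u k\<bar> > \<bar>p (\<lambda>i. real (v i))\<bar> / 2" for n
    proof -
      obtain k where k: "k \<ge> n" "\<And>i. i < N \<Longrightarrow> indep_fun (c i) k = v i"
        using indep_fun_attains[OF inj] by blast
      have "u k = p (\<lambda>i. real (v i))"
        unfolding u_def p_def using P(1) k(2)
        by (intro sum.cong prod.cong refl arg_cong2[where f = "(*)"]) (auto simp: mpoly_in_vars_def subset_iff)
      with v k(1) show ?thesis by auto
    qed
    with v have "mpoly_eval (L0_seq_algebra M) x P \<notin> S_m M"
      unfolding eval by (intro tail_fun_notin_S_m[OF A pos, of "\<bar>p (\<lambda>i. real (v i))\<bar> / 2"]) auto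
    \<comment> \<open>Being outside \<open>S_m M\<close>, the evaluated polynomial differs from zero
      as well.\<close>
    moreover have "\<zero>\<^bsub>L0_seq_algebra M\<^esub> \<in> S_m M"
      by (simp add: L0_seq_ops S_m_iff)
    ultimately show ?thesis using tail_fun_in_S_p[OF A, of u] by (auto simp: eval)
  qed
  ultimately show ?thesis unfolding strongly_c_algebrable_def by (intro exI[of _ "range F"]) blast
qed

theorem theorem4p3:
  fixes M :: "'a measure" and A :: "nat \<Rightarrow> 'a set"
  assumes "range A \<subseteq> sets M"
    and "disjoint_family A"
    and "(INF n. emeasure M (A n)) > 0"
  shows "strongly_c_algebrable (L0_seq_algebra M) (S_p M - S_m M)
    \<and> strongly_c_algebrable (L0_seq_algebra M) (S_p M - (\<Union>q\<in>{0<..}. S_L q M))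
    \<and> strongly_c_algebrable (L0_seq_algebra M) (S_p M - S_c M)
    \<and> strongly_c_algebrable (L0_seq_algebra M) (S_p M - S_au M)
    \<and> strongly_c_algebrable (L0_seq_algebra M) (S_p M - S_u M)"
proof -
  have "strongly_c_algebrable (L0_seq_algebra M) (S_p M - S)" if "S \<subseteq> S_m M" for S
    by (rule strongly_c_algebrable_mono[OF S_p_minus_S_m_strongly_c_algebrable[OF assms]])
      (use that in blast)
  moreover have "(\<Union>q\<in>{0<..}. S_L q M) \<subseteq> S_m M"
    using S_L_subset_S_m by fastforce
  ultimately show ?thesis
    \<comment> \<open>Uniform convergence is handled through almost uniform convergence.\<close>
    using S_c_subset_S_m[of M] S_au_subset_S_m[of M] S_u_subset_S_au[of M] by blast
qed

end
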